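(* Suppose every EV has zero laxity, i.e. $\Delta_T\, r_{\max}\, d_i=e_i$ for every $i\in\mathcal{N}$. Consider the original phase optimization problem $$\text{(P1)}\qquad \min_{X\in\mathbb{Z}_+^{3\times N},\ A\in\mathbb{R}_+^{N\times T}} f_{\mathbf 1}(A)\quad\text{s.t.}\quad X\in\mathcal{X},\quad A\in\mathcal{C}_{\mathrm r}\cap\mathcal{C}_{\mathrm d},\quad (X,A)\in\mathcal{C}_{\mathrm{soc}},$$ and the problem $$\text{(P2)}\qquad \min_{X\in\mathbb{Z}_+^{3\times N},\ P\in\mathbb{R}_+^{3\times T}} g_{\mathbf 1}(P)\quad\text{s.t.}\quad X\in\mathcal{X},\quad PM\le XW,\quad \left|\begin{bmatrix}\Phi_1\\ \Phi_2\end{bmatrix}P\right|\le C_{\max},$$ with $M=I_T$ (the $T\times T$ identity matrix) and $W=r_{\max}E$. Let $\mathcal{X}^*$ be the set of all $X^*$ for which there is an $A^*$ such that $(X^*,A^* )$ is an optimal solution of (P1). Then for every optimal solution $(X,P)$ of (P2), $X\in\mathcal{X}^*$.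
   Context: Let $N,T\ge 1$ be integers, $\mathcal{N}=\{1,\dots,N\}$ (electric vehicles, EVs, arriving at a charging network during the time horizon) and $\mathcal{T}=\{1,\dots,T\}$ (the discrete time horizon). $\mathbb{R}_+,\mathbb{Z}_+$ denote the non-negative reals and integers. Matrix inequalities are entrywise, and $|\cdot|$ applied to a complex matrix is the entrywise modulus. For a matrix $A$, $A_{(i,j)}$ is its $(i,j)$ entry. For real $a$ and angle $\theta$ (in degrees), $a\angle\theta$ denotes the complex number $a e^{\mathrm{i}\theta}$. Data: each EV $i$ has a charging profile $[a_i,d_i,e_i]\in\mathbb{R}_+^3$, where $a_i$ (hours) is the arrival time, $d_i$ (hours) is the charging duration, and $e_i$ (kWh) is the initial energy demand. The presence matrix $E\in\{0,1\}^{N\times T}$ is defined by $E_{(i,j)}=1$ if $a_i\le j\le a_i+d_i$ and $E_{(i,j)}=0$ otherwise. $r_{\max}\in\mathbb{R}_+$ is the maximum charger rate (the same for all chargers), $\Delta_T>0$ is the length of a time step, $n_r>0$ is the transformer turning-ratio, and $c_1,c_2\ge 0$ are line-power limits. Phase selection matrices: $\mathcal{X}=\{X\in\{0,1\}^{3\times N} : \sum_{i=1}^3 X_{(i,j)}=1 \text{ for all } j\in\mathcal{N}\}$. Charger constraint: $\mathcal{C}_{\mathrm r}=\{A\in\mathbb{R}_+^{N\times T} : 0\le A\le r_{\max}E\}$. Demand constraint: $\mathcal{C}_{\mathrm d}=\{A\in\mathbb{R}_+^{N\times T} : \Delta_T\sum_{j=1}^T A_{(i,j)}\le e_i \text{ for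 all } i\in\mathcal{N}\}$. Network constraint: $\mathcal{C}_{\mathrm{soc}}$ is the set of all pairs $(X,A)\in\mathcal{X}\times\mathbb{R}_+^{N\times T}$ with $\left|\begin{bmatrix}\Phi_1\\ \Phi_2\end{bmatrix}XA\right|\le C_{\max}$, where $C_{\max}\in\mathbb{R}^{6\times T}$ has all entries of rows $1,2,3$ equal to $c_1$ and all entries of rows $4,5,6$ equal to $c_2$, and $$\Phi_1=\begin{bmatrix}1\angle30^\circ & 0 & -1\angle150^\circ\\ -1\angle30^\circ & 1\angle{-90^\circ} & 0\\ 0 & -1\angle{-90^\circ} & 1\angle150^\circ\end{bmatrix},\qquad \Phi_2=\frac1{n_r}\begin{bmatrix}1\angle30^\circ & 1\angle{-90^\circ} & -2\angle150^\circ\\ -2\angle30^\circ & 1\angle{-90^\circ} & 1\angle150^\circ\\ 1\angle30^\circ & -2\angle{-90^\circ} & 1\angle150^\circ\end{bmatrix}.$$ Objectives: $f_{\mathbf 1}(A)=-\sum_{i=1}^N\sum_{j=1}^T A_{(i,j)}$ for $A\in\mathbb{R}^{N\times T}$, and $g_{\mathbf 1}(P)=-\sum_{i=1}^3\sum_{j=1}^T P_{(i,j)}$ for $P\in\mathbb{R}^{3\times T}$.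
   Formalization: Adds the assumption that for each EV i the number of time steps j in {1,…,T} with a_i ≤ j ≤ a_i+d_i is at most d_i; without it, zero laxity does not make the charger constraint imply the demand constraint and the claim fails. *)

theory Defs
  imports Complex_Main "Jordan_Normal_Form.Matrix"
begin

text \<open>Matrices are those of \<^theory>\<open>Jordan_Normal_Form.Matrix\<close>, whose order is entrywise and whose
  indices start at 0. EVs are therefore numbered \<open>0, ..., N - 1\<close>, and column \<open>j\<close> of an
  \<open>N \<times> T\<close> matrix stands for time step \<open>j + 1\<close>.\<close>

definition nonneg_mats :: "nat \<Rightarrow> nat \<Rightarrow> real mat set" where
  "nonneg_mats m n = {A \<in> carrier_mat m n. \<forall>i<m. \<forall>j<n. 0 \<le> A $$ (i,j)}"

definition nonneg_int_mats :: "nat \<Rightarrow> nat \<Rightarrow> real mat set" where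
  "nonneg_int_mats m n = {X \<in> carrier_mat m n. \<forall>i<m. \<forall>j<n. X $$ (i,j) \<in> \<nat>}"

definition phasor :: "real \<Rightarrow> real \<Rightarrow> complex" (infix "\<angle>" 75) where
  "r \<angle> \<theta> = rcis r (\<theta> * pi / 180)"

definition Phi1 :: "complex mat" where
  "Phi1 = mat_of_rows_list 3
     [[1 \<angle> 30, 0, - (1 \<angle> 150)],
      [- (1 \<angle> 30), 1 \<angle> (-90), 0],
      [0, - (1 \<angle> (-90)), 1 \<angle> 150]]"

definition Phi2 :: "real \<Rightarrow> complex mat" where
  "Phi2 n\<^sub>r = complex_of_real (1 / n\<^sub>r) \<cdot>\<^sub>m mat_of_rows_list 3
     [[1 \<angle> 30, 1 \<angle> (-90), - (2 \<angle> 150)],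
      [- (2 \<angle> 30), 1 \<angle> (-90), 1 \<angle> 150],
      [1 \<angle> 30, - (2 \<angle> (-90)), 1 \<angle> 150]]"

definition Phi :: "real \<Rightarrow> complex mat" where
  "Phi n\<^sub>r = Phi1 @\<^sub>r Phi2 n\<^sub>r"

definition C_max :: "nat \<Rightarrow> real \<Rightarrow> real \<Rightarrow> real mat" where
  "C_max T c\<^sub>1 c\<^sub>2 = mat 6 T (\<lambda>(i,j). if i < 3 then c\<^sub>1 else c\<^sub>2)"

abbreviation cmat :: "real mat \<Rightarrow> complex mat" where
  "cmat \<equiv> map_mat complex_of_real"

definition presence :: "nat \<Rightarrow> nat \<Rightarrow> (nat \<Rightarrow> real) \<Rightarrow> (nat \<Rightarrow> real) \<Rightarrow> real mat" where
  "presence N T a d =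
     mat N T (\<lambda>(i,j). if a i \<le> real (j + 1) \<and> real (j + 1) \<le> a i + d i then 1 else 0)"

definition phase_selections :: "nat \<Rightarrow> real mat set" where
  "phase_selections N = {X \<in> carrier_mat 3 N.
     (\<forall>i<3. \<forall>j<N. X $$ (i,j) \<in> {0, 1}) \<and> (\<forall>j<N. (\<Sum>i<3. X $$ (i,j)) = 1)}"

definition C_r :: "nat \<Rightarrow> nat \<Rightarrow> (nat \<Rightarrow> real) \<Rightarrow> (nat \<Rightarrow> real) \<Rightarrow> real \<Rightarrow> real mat set" where
  "C_r N T a d r\<^sub>m\<^sub>a\<^sub>x =
     {A \<in> nonneg_mats N T. 0\<^sub>m N T \<le> A \<and> A \<le> r\<^sub>m\<^sub>a\<^sub>x \<cdot>\<^sub>m presence N T a d}"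

definition C_d :: "nat \<Rightarrow> nat \<Rightarrow> real \<Rightarrow> (nat \<Rightarrow> real) \<Rightarrow> real mat set" where
  "C_d N T \<Delta> e = {A \<in> nonneg_mats N T. \<forall>i<N. \<Delta> * (\<Sum>j<T. A $$ (i,j)) \<le> e i}"

definition C_soc :: "nat \<Rightarrow> nat \<Rightarrow> real \<Rightarrow> real \<Rightarrow> real \<Rightarrow> (real mat \<times> real mat) set" where
  "C_soc N T n\<^sub>r c\<^sub>1 c\<^sub>2 = {(X, A). X \<in> phase_selections N \<and> A \<in> nonneg_mats N T \<and>
     map_mat cmod (Phi n\<^sub>r * cmat X * cmat A) \<le> C_max T c\<^sub>1 c\<^sub>2}"

definition f_one :: "nat \<Rightarrow> nat \<Rightarrow> real mat \<Rightarrow> real" where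
  "f_one N T A = - (\<Sum>i<N. \<Sum>j<T. A $$ (i,j))"

definition g_one :: "nat \<Rightarrow> real mat \<Rightarrow> real" where
  "g_one T P = - (\<Sum>i<3. \<Sum>j<T. P $$ (i,j))"

definition P1_feasible ::
  "nat \<Rightarrow> nat \<Rightarrow> (nat \<Rightarrow> real) \<Rightarrow> (nat \<Rightarrow> real) \<Rightarrow> (nat \<Rightarrow> real) \<Rightarrow> real \<Rightarrow> real \<Rightarrow> real \<Rightarrow> real \<Rightarrow> real
    \<Rightarrow> real mat \<times> real mat \<Rightarrow> bool" where
  "P1_feasible N T a d e r\<^sub>m\<^sub>a\<^sub>x \<Delta> n\<^sub>r c\<^sub>1 c\<^sub>2 = (\<lambda>(X, A).
     X \<in> nonneg_int_mats 3 N \<and> A \<in> nonneg_mats N T \<and>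
     X \<in> phase_selections N \<and> A \<in> C_r N T a d r\<^sub>m\<^sub>a\<^sub>x \<inter> C_d N T \<Delta> e \<and>
     (X, A) \<in> C_soc N T n\<^sub>r c\<^sub>1 c\<^sub>2)"

definition P1_optimal ::
  "nat \<Rightarrow> nat \<Rightarrow> (nat \<Rightarrow> real) \<Rightarrow> (nat \<Rightarrow> real) \<Rightarrow> (nat \<Rightarrow> real) \<Rightarrow> real \<Rightarrow> real \<Rightarrow> real \<Rightarrow> real \<Rightarrow> real
    \<Rightarrow> real mat \<times> real mat \<Rightarrow> bool" where
  "P1_optimal N T a d e r\<^sub>m\<^sub>a\<^sub>x \<Delta> n\<^sub>r c\<^sub>1 c\<^sub>2 =
     is_arg_min (\<lambda>(X, A). f_one N T A) (P1_feasible N T a d e r\<^sub>m\<^sub>a\<^sub>x \<Delta> n\<^sub>r c\<^sub>1 c\<^sub>2)"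

definition P2_feasible ::
  "nat \<Rightarrow> nat \<Rightarrow> real mat \<Rightarrow> real mat \<Rightarrow> real \<Rightarrow> real \<Rightarrow> real \<Rightarrow> real mat \<times> real mat \<Rightarrow> bool" where
  "P2_feasible N T M W n\<^sub>r c\<^sub>1 c\<^sub>2 = (\<lambda>(X, P).
     X \<in> nonneg_int_mats 3 N \<and> P \<in> nonneg_mats 3 T \<and>
     X \<in> phase_selections N \<and> P * M \<le> X * W \<and>
     map_mat cmod (Phi n\<^sub>r * cmat P) \<le> C_max T c\<^sub>1 c\<^sub>2)"

definition P2_optimal ::
  "nat \<Rightarrow> nat \<Rightarrow> real mat \<Rightarrow> real mat \<Rightarrow> real \<Rightarrow> real \<Rightarrow> real \<Rightarrow> real mat \<times> real mat \<Rightarrow> bool" where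
  "P2_optimal N T M W n\<^sub>r c\<^sub>1 c\<^sub>2 =
     is_arg_min (\<lambda>(X, P). g_one T P) (P2_feasible N T M W n\<^sub>r c\<^sub>1 c\<^sub>2)"

definition X_star ::
  "nat \<Rightarrow> nat \<Rightarrow> (nat \<Rightarrow> real) \<Rightarrow> (nat \<Rightarrow> real) \<Rightarrow> (nat \<Rightarrow> real) \<Rightarrow> real \<Rightarrow> real \<Rightarrow> real \<Rightarrow> real \<Rightarrow> real
    \<Rightarrow> real mat set" where
  "X_star N T a d e r\<^sub>m\<^sub>a\<^sub>x \<Delta> n\<^sub>r c\<^sub>1 c\<^sub>2 = {X. \<exists>A. P1_optimal N T a d e r\<^sub>m\<^sub>a\<^sub>x \<Delta> n\<^sub>r c\<^sub>1 c\<^sub>2 (X, A)}"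

text \<open>Zero laxity means that charging at the full rate throughout the stay delivers exactly the
  demand. The identity \<open>\<Delta> * r\<^sub>m\<^sub>a\<^sub>x * d i = e i\<close> expresses this only if the duration \<open>d i\<close> counts the
  time steps of the stay. The presence matrix alone does not ensure it: the interval from \<open>a i\<close>
  to \<open>a i + d i\<close> is closed at both ends, so for integers \<open>a i\<close> and \<open>d i\<close> it can contain \<open>d i + 1\<close>
  time steps, and then the demand constraint cuts off points allowed by the charger constraint.
  The predicate below states the convention; it is an inequality because part of a stay may lie
  beyond the horizon.\<close>

definition durations_count_steps ::
  "nat \<Rightarrow> nat \<Rightarrow> (nat \<Rightarrow> real) \<Rightarrow> (nat \<Rightarrow> real) \<Rightarrow> bool" where
  "durations_count_steps N T a d \<longleftrightarrow>
     (\<forall>i<N. real (card {j \<in> {1..T}. a i \<le> real j \<and> real j \<le> a i + d i}) \<le> d i)"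

end

theory Submission
  imports Defs
begin

text \<open>The two problems have the same optimal value for each fixed phase selection \<open>X\<close>, because the
  phase loads \<open>P\<close> of (P2) are exactly the products \<open>X * A\<close> of rate matrices \<open>A\<close> of (P1).

  In one direction, every column of \<open>X\<close> sums to 1, so \<open>X * A\<close> carries the same total power as \<open>A\<close>,
  and multiplication by the nonnegative \<open>X\<close> turns \<open>A \<le> W\<close> into \<open>X * A \<le> X * W\<close>
  (\<open>P1_feasible_imp_P2_feasible\<close>). In the other direction, loads \<open>P \<le> X * W\<close> are split among the
  vehicles on each phase in proportion to their caps, the entries of \<open>W\<close> (\<open>proportional_split\<close>).
  Phases do not interact in this splitting, since a vehicle is connected to one phase only. Each
  vehicle stays below its cap, and zero laxity makes the cap imply the demand constraint
  (\<open>C_r_subset_C_d\<close>). The network constraint sees \<open>A\<close> only through \<open>X * A\<close>.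

  An optimal \<open>(X, P)\<close> of (P2) therefore lifts to a feasible \<open>(X, A)\<close> of (P1) with the same value,
  and any better \<open>(X', A')\<close> would give a better \<open>(X', X' * A')\<close> in (P2).\<close>

section \<open>Matrix products with phase selections\<close>

lemma mult_mat_entry:
  assumes "A \<in> carrier_mat m n" "B \<in> carrier_mat n p" "i < m" "j < p"
  shows "(A * B) $$ (i,j) = (\<Sum>k<n. A $$ (i,k) * B $$ (k,j))"
  using assms by (auto simp: scalar_prod_def lessThan_atLeast0 intro!: sum.cong)

lemma mult_mat_left_mono:
  fixes X A B :: "real mat"
  assumes X: "X \<in> nonneg_mats m n" and B: "B \<in> carrier_mat n p" and AB: "A \<le> B"
  shows "X * A \<le> X * B"
proof -
  have Xc: "X \<in> carrier_mat m n" and X0: "\<And>i j. i < m \<Longrightarrow> j < n \<Longrightarrow> 0 \<le> X $$ (i,j)"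
    using X by (auto simp: nonneg_mats_def)
  have A: "A \<in> carrier_mat n p" and le: "\<And>i j. i < n \<Longrightarrow> j < p \<Longrightarrow> A $$ (i,j) \<le> B $$ (i,j)"
    using AB B by (auto simp: less_eq_mat_def)
  have "(X * A) $$ (i,j) \<le> (X * B) $$ (i,j)" if "i < m" "j < p" for i j
    unfolding mult_mat_entry[OF Xc A that] mult_mat_entry[OF Xc B that]
    using that by (intro sum_mono mult_left_mono le X0) auto
  then show ?thesis
    using Xc A B by (auto simp: less_eq_mat_def simp del: index_mult_mat(1))
qed

lemma mult_mat_nonneg:
  assumes X: "X \<in> nonneg_mats m n" and A: "A \<in> nonneg_mats n p"
  shows "X * A \<in> nonneg_mats m p"
proof -
  have Xc: "X \<in> carrier_mat m n" and Ac: "A \<in> carrier_mat n p"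
    using assms by (auto simp: nonneg_mats_def)
  have "0 \<le> (X * A) $$ (i,j)" if "i < m" "j < p" for i j
    unfolding mult_mat_entry[OF Xc Ac that]
    using X A that by (intro sum_nonneg mult_nonneg_nonneg) (auto simp: nonneg_mats_def)
  then show ?thesis
    using Xc Ac by (auto simp: nonneg_mats_def simp del: index_mult_mat(1))
qed

lemma phase_selections_nonneg:
  "X \<in> phase_selections N \<Longrightarrow> X \<in> nonneg_mats 3 N"
  unfolding phase_selections_def nonneg_mats_def by force

lemma phase_selections_entry_mult:
  assumes X: "X \<in> phase_selections N" and "k < 3" "l < 3" "i < N"
  shows "X $$ (k,i) * X $$ (l,i) = (if k = l then X $$ (k,i) else 0)"
proof -
  have bin: "X $$ (m,i) \<in> {0,1}" if "m < 3" for m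
    using X that \<open>i < N\<close> by (auto simp: phase_selections_def)
  have one: "(\<Sum>m<3. X $$ (m,i)) = 1"
    using X \<open>i < N\<close> by (auto simp: phase_selections_def)
  have False if "k \<noteq> l" "X $$ (k,i) = 1" "X $$ (l,i) = 1"
  proof -
    have "(\<Sum>m\<in>{k,l}. X $$ (m,i)) \<le> (\<Sum>m<3. X $$ (m,i))"
      using bin \<open>k < 3\<close> \<open>l < 3\<close> by (intro sum_mono2) force+
    with that one show False by simp
  qed
  then show ?thesis using bin[OF \<open>k < 3\<close>] bin[OF \<open>l < 3\<close>] by auto
qed

text \<open>Total power is preserved because the columns of \<open>X\<close> sum to 1.\<close>

lemma g_one_mult_phase_selection:
  assumes X: "X \<in> phase_selections N" and A: "A \<in> carrier_mat N T"
  shows "g_one T (X * A) = f_one N T A"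
proof -
  have Xc: "X \<in> carrier_mat 3 N" using X by (simp add: phase_selections_def)
  have "(\<Sum>k<3. \<Sum>j<T. (X * A) $$ (k,j)) = (\<Sum>k<3. \<Sum>j<T. \<Sum>i<N. X $$ (k,i) * A $$ (i,j))"
    by (intro sum.cong refl mult_mat_entry[OF Xc A]) auto
  also have "\<dots> = (\<Sum>k<3. \<Sum>i<N. \<Sum>j<T. X $$ (k,i) * A $$ (i,j))"
    by (intro sum.cong refl sum.swap)
  also have "\<dots> = (\<Sum>i<N. \<Sum>k<3. \<Sum>j<T. X $$ (k,i) * A $$ (i,j))"
    by (rule sum.swap)
  also have "\<dots> = (\<Sum>i<N. (\<Sum>k<3. X $$ (k,i)) * (\<Sum>j<T. A $$ (i,j)))"
    by (simp only: sum_product)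
  also have "\<dots> = (\<Sum>i<N. \<Sum>j<T. A $$ (i,j))"
    using X by (intro sum.cong) (auto simp: phase_selections_def)
  finally show ?thesis by (simp add: g_one_def f_one_def)
qed

text \<open>On each phase at each time, every connected vehicle gets the same fraction \<open>P / (X * W)\<close> of its
  cap. The fraction lies in \<open>[0, 1]\<close>, and it multiplies the total cap \<open>X * W\<close> of the phase back
  to \<open>P\<close>.\<close>

lemma proportional_split:
  assumes X: "X \<in> phase_selections N" and W: "W \<in> nonneg_mats N T"
    and P: "P \<in> nonneg_mats 3 T" and le: "P \<le> X * W"
  shows "\<exists>A \<in> nonneg_mats N T. A \<le> W \<and> X * A = P"
proof -
  have Xc: "X \<in> carrier_mat 3 N" using X by (simp add: phase_selections_def)
  have Wc: "W \<in> carrier_mat N T" and W0: "\<And>i j. i < N \<Longrightarrow> j < T \<Longrightarrow> 0 \<le> W $$ (i,j)"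
    using W by (auto simp: nonneg_mats_def)
  have Pc: "P \<in> carrier_mat 3 T" and P0: "\<And>k j. k < 3 \<Longrightarrow> j < T \<Longrightarrow> 0 \<le> P $$ (k,j)"
    using P by (auto simp: nonneg_mats_def)
  have Ple: "P $$ (k,j) \<le> (X * W) $$ (k,j)" if "k < 3" "j < T" for k j
    using le that Xc Wc by (auto simp: less_eq_mat_def simp del: index_mult_mat(1))
  define q where "q k j = P $$ (k,j) / (X * W) $$ (k,j)" for k j
  (* If the total cap vanishes then so does the load, and the quotient is 0 / 0 = 0. *)
  have q: "0 \<le> q k j" "q k j \<le> 1" "(X * W) $$ (k,j) * q k j = P $$ (k,j)"
    if "k < 3" "j < T" for k j
    using P0[OF that] Ple[OF that] by (auto simp: q_def divide_le_eq)
  (* The sum over l picks the fraction of the single phase to which vehicle i is connected. *)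
  define s where "s i j = (\<Sum>l<3. X $$ (l,i) * q l j)" for i j
  have X0: "0 \<le> X $$ (l,i)" if "l < 3" "i < N" for l i
    using phase_selections_nonneg[OF X] that by (simp add: nonneg_mats_def)
  have s0: "0 \<le> s i j" if "i < N" "j < T" for i j
    unfolding s_def using that by (intro sum_nonneg mult_nonneg_nonneg X0 q) auto
  have s1: "s i j \<le> 1" if "i < N" "j < T" for i j
  proof -
    have "s i j \<le> (\<Sum>l<3. X $$ (l,i) * 1)"
      unfolding s_def using that by (intro sum_mono mult_left_mono X0 q) auto
    also have "\<dots> = 1" using X that by (simp add: phase_selections_def)
    finally show ?thesis .
  qed
  have Xs: "X $$ (k,i) * s i j = X $$ (k,i) * q k j" if "k < 3" "i < N" for k i j
  proof -
    have "X $$ (k,i) * s i j = (\<Sum>l<3. (X $$ (k,i) * X $$ (l,i)) * q l j)"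
      by (simp add: s_def sum_distrib_left mult.assoc)
    also have "\<dots> = (\<Sum>l<3. if l = k then X $$ (k,i) * q k j else 0)"
      using that by (intro sum.cong) (auto simp: phase_selections_entry_mult[OF X])
    also have "\<dots> = X $$ (k,i) * q k j" using \<open>k < 3\<close> by simp
    finally show ?thesis .
  qed
  define A where "A = mat N T (\<lambda>(i,j). W $$ (i,j) * s i j)"
  have Ac: "A \<in> carrier_mat N T" by (simp add: A_def)
  have "A \<in> nonneg_mats N T"
    using W0 s0 by (auto simp: A_def nonneg_mats_def)
  moreover have "A \<le> W"
    using Wc W0 s1 by (auto simp: A_def less_eq_mat_def intro!: mult_left_le)
  moreover have "X * A = P"
  proof (rule eq_matI)
    fix k j assume "k < dim_row P" "j < dim_col P"
    then have kj: "k < 3" "j < T" using Pc by auto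
    have "(X * A) $$ (k,j) = (\<Sum>i<N. W $$ (i,j) * (X $$ (k,i) * s i j))"
      unfolding mult_mat_entry[OF Xc Ac kj] using kj by (intro sum.cong) (auto simp: A_def)
    also have "\<dots> = (\<Sum>i<N. W $$ (i,j) * (X $$ (k,i) * q k j))"
      using kj by (simp add: Xs)
    also have "\<dots> = (X * W) $$ (k,j) * q k j"
      unfolding mult_mat_entry[OF Xc Wc kj] by (simp add: sum_distrib_left sum_distrib_right mult_ac)
    finally show "(X * A) $$ (k,j) = P $$ (k,j)" using q(3)[OF kj] by simp
  qed (use Xc Ac Pc in auto)
  ultimately show ?thesis by blast
qed

section \<open>Correspondence of the two problems\<close>

lemma Phi_carrier: "Phi n\<^sub>r \<in> carrier_mat 6 3"
proof -
  have "Phi1 \<in> carrier_mat 3 3" "Phi2 n\<^sub>r \<in> carrier_mat 3 3"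
    by (auto simp: Phi1_def Phi2_def mat_of_rows_list_def)
  from carrier_append_rows[OF this] show ?thesis by (simp add: Phi_def)
qed

lemma Phi_mult_cmat:
  assumes X: "X \<in> carrier_mat 3 N" and A: "A \<in> carrier_mat N T"
  shows "Phi n\<^sub>r * cmat X * cmat A = Phi n\<^sub>r * cmat (X * A)"
proof -
  have "cmat (X * A) = cmat X * cmat A" by (rule of_real_hom.mat_hom_mult[OF X A])
  then show ?thesis
    using assoc_mult_mat[OF Phi_carrier, of "cmat X" N "cmat A" T] assms by simp
qed

lemma caps_nonneg:
  "0 \<le> r \<Longrightarrow> r \<cdot>\<^sub>m presence N T a d \<in> nonneg_mats N T"
  by (auto simp: presence_def nonneg_mats_def)

text \<open>Row \<open>i\<close> of the presence matrix sums to the number of time steps at which vehicle \<open>i\<close> is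
  present. This is at most \<open>d i\<close>, so even charging at the full rate throughout delivers no more
  than \<open>\<Delta> * r * d i\<close>, which is the demand.\<close>

lemma C_r_subset_C_d:
  assumes r: "0 \<le> r" and D: "0 < \<Delta>"
    and steps: "durations_count_steps N T a d"
    and laxity: "\<forall>i<N. \<Delta> * r * d i = e i"
  shows "C_r N T a d r \<subseteq> C_d N T \<Delta> e"
proof
  fix A assume A: "A \<in> C_r N T a d r"
  then have AW: "A \<le> r \<cdot>\<^sub>m presence N T a d" by (simp add: C_r_def)
  have "\<Delta> * (\<Sum>j<T. A $$ (i,j)) \<le> e i" if i: "i < N" for i
  proof -
    define S where "S = {j. a i \<le> real j \<and> real j \<le> a i + d i}"
    have cap: "A $$ (i,j) \<le> r * (if Suc j \<in> S then 1 else 0)" if "j < T" for j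
    proof -
      have "A $$ (i,j) \<le> (r \<cdot>\<^sub>m presence N T a d) $$ (i,j)"
        using AW i that unfolding less_eq_mat_def by (auto simp: presence_def)
      also have "\<dots> = r * (if Suc j \<in> S then 1 else 0)"
        using i that by (simp add: presence_def S_def)
      finally show ?thesis .
    qed
    then have "(\<Sum>j<T. A $$ (i,j)) \<le> (\<Sum>j<T. r * (if Suc j \<in> S then 1 else 0))"
      by (intro sum_mono) simp
    also have "\<dots> = r * (\<Sum>j<T. if Suc j \<in> S then 1 else 0)"
      by (rule sum_distrib_left[symmetric])
    also have "(\<Sum>j<T. if Suc j \<in> S then 1 else 0) = (\<Sum>j\<in>{1..T}. if j \<in> S then 1 else (0::real))"
      by (rule sum.reindex_bij_witness[of _ "\<lambda>j. j - 1" Suc]) auto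
    also have "\<dots> = real (card {j \<in> {1..T}. a i \<le> real j \<and> real j \<le> a i + d i})"
      by (subst sum.inter_filter[symmetric]) (auto simp: S_def)
    also have "r * \<dots> \<le> r * d i"
      using steps i r by (intro mult_left_mono) (auto simp: durations_count_steps_def)
    finally have "\<Delta> * (\<Sum>j<T. A $$ (i,j)) \<le> \<Delta> * (r * d i)"
      using D by (intro mult_left_mono) auto
    with laxity i show ?thesis by (simp add: mult.assoc)
  qed
  with A show "A \<in> C_d N T \<Delta> e" by (auto simp: C_r_def C_d_def)
qed

lemma P1_feasible_imp_P2_feasible:
  assumes feas: "P1_feasible N T a d e r \<Delta> n\<^sub>r c\<^sub>1 c\<^sub>2 (X, A)"
  shows "P2_feasible N T (1\<^sub>m T) (r \<cdot>\<^sub>m presence N T a d) n\<^sub>r c\<^sub>1 c\<^sub>2 (X, X * A)"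
proof -
  let ?W = "r \<cdot>\<^sub>m presence N T a d"
  have X: "X \<in> phase_selections N" and A: "A \<in> nonneg_mats N T" and AW: "A \<le> ?W"
    and Xint: "X \<in> nonneg_int_mats 3 N"
    and soc: "map_mat cmod (Phi n\<^sub>r * cmat X * cmat A) \<le> C_max T c\<^sub>1 c\<^sub>2"
    using feas by (auto simp: P1_feasible_def C_r_def C_soc_def)
  note X0 = phase_selections_nonneg[OF X]
  have Xc: "X \<in> carrier_mat 3 N" and Ac: "A \<in> carrier_mat N T"
    using X0 A by (auto simp: nonneg_mats_def)
  have "?W \<in> carrier_mat N T" by (simp add: presence_def)
  then have "X * A \<le> X * ?W" by (rule mult_mat_left_mono[OF X0 _ AW])
  moreover have "X * A * 1\<^sub>m T = X * A"
    by (rule right_mult_one_mat) (use Xc Ac in auto)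
  ultimately show ?thesis
    using X Xint mult_mat_nonneg[OF X0 A] soc
    by (simp add: P2_feasible_def Phi_mult_cmat[OF Xc Ac])
qed

lemma P2_feasible_imp_P1_feasible:
  assumes r: "0 \<le> r" and CrCd: "C_r N T a d r \<subseteq> C_d N T \<Delta> e"
    and feas: "P2_feasible N T (1\<^sub>m T) (r \<cdot>\<^sub>m presence N T a d) n\<^sub>r c\<^sub>1 c\<^sub>2 (X, P)"
  shows "\<exists>A. P1_feasible N T a d e r \<Delta> n\<^sub>r c\<^sub>1 c\<^sub>2 (X, A) \<and> X * A = P"
proof -
  let ?W = "r \<cdot>\<^sub>m presence N T a d"
  have X: "X \<in> phase_selections N" and Xint: "X \<in> nonneg_int_mats 3 N"
    and P: "P \<in> nonneg_mats 3 T" and "P * 1\<^sub>m T \<le> X * ?W"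
    and soc: "map_mat cmod (Phi n\<^sub>r * cmat P) \<le> C_max T c\<^sub>1 c\<^sub>2"
    using feas by (auto simp: P2_feasible_def)
  moreover have "P * 1\<^sub>m T = P"
    using P by (intro right_mult_one_mat[where nr = 3]) (simp add: nonneg_mats_def)
  ultimately have "P \<le> X * ?W" by simp
  then obtain A where A: "A \<in> nonneg_mats N T" and AW: "A \<le> ?W" and XA: "X * A = P"
    using proportional_split[OF X caps_nonneg[OF r] P] by blast
  have Xc: "X \<in> carrier_mat 3 N" and Ac: "A \<in> carrier_mat N T"
    using X A by (auto simp: phase_selections_def nonneg_mats_def)
  have "A \<in> C_r N T a d r"
    using A AW by (auto simp: C_r_def nonneg_mats_def less_eq_mat_def)
  then have "P1_feasible N T a d e r \<Delta> n\<^sub>r c\<^sub>1 c\<^sub>2 (X, A)"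
    using CrCd X Xint A soc by (auto simp: P1_feasible_def C_soc_def Phi_mult_cmat[OF Xc Ac] XA)
  with XA show ?thesis by blast
qed

theorem theoremV1:
  fixes N T :: nat
    and a d e :: "nat \<Rightarrow> real"
    and r\<^sub>m\<^sub>a\<^sub>x \<Delta> n\<^sub>r c\<^sub>1 c\<^sub>2 :: real
    and X P :: "real mat"
  assumes "1 \<le> N" and "1 \<le> T"
    and "\<forall>i<N. 0 \<le> a i \<and> 0 \<le> d i \<and> 0 \<le> e i"
    and "0 \<le> r\<^sub>m\<^sub>a\<^sub>x" and "0 < \<Delta>" and "0 < n\<^sub>r" and "0 \<le> c\<^sub>1" and "0 \<le> c\<^sub>2"
    and "durations_count_steps N T a d"
    and zero_laxity: "\<forall>i<N. \<Delta> * r\<^sub>m\<^sub>a\<^sub>x * d i = e i"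
    and "P2_optimal N T (1\<^sub>m T) (r\<^sub>m\<^sub>a\<^sub>x \<cdot>\<^sub>m presence N T a d) n\<^sub>r c\<^sub>1 c\<^sub>2 (X, P)"
  shows "X \<in> X_star N T a d e r\<^sub>m\<^sub>a\<^sub>x \<Delta> n\<^sub>r c\<^sub>1 c\<^sub>2"
proof -
  let ?W = "r\<^sub>m\<^sub>a\<^sub>x \<cdot>\<^sub>m presence N T a d"
  let ?F1 = "P1_feasible N T a d e r\<^sub>m\<^sub>a\<^sub>x \<Delta> n\<^sub>r c\<^sub>1 c\<^sub>2"
  let ?F2 = "P2_feasible N T (1\<^sub>m T) ?W n\<^sub>r c\<^sub>1 c\<^sub>2"
  have feas: "?F2 (X, P)" and opt: "\<And>X' P'. ?F2 (X', P') \<Longrightarrow> g_one T P \<le> g_one T P'"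
    using assms(11) by (force simp: P2_optimal_def is_arg_min_def)+
  have value_eq: "g_one T (X' * A') = f_one N T A'" if "?F1 (X', A')" for X' A'
    using that by (intro g_one_mult_phase_selection) (auto simp: P1_feasible_def nonneg_mats_def)
  have "C_r N T a d r\<^sub>m\<^sub>a\<^sub>x \<subseteq> C_d N T \<Delta> e"
    using assms by (intro C_r_subset_C_d) auto
  from P2_feasible_imp_P1_feasible[OF \<open>0 \<le> r\<^sub>m\<^sub>a\<^sub>x\<close> this feas]
  obtain A where A: "?F1 (X, A)" and XA: "X * A = P" by blast
  have "f_one N T A \<le> f_one N T A'" if "?F1 (X', A')" for X' A'
    using opt[OF P1_feasible_imp_P2_feasible[OF that]] value_eq[OF that] value_eq[OF A] XA by simp
  with A have "P1_optimal N T a d e r\<^sub>m\<^sub>a\<^sub>x \<Delta> n\<^sub>r c\<^sub>1 c\<^sub>2 (X, A)"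
    by (force simp: P1_optimal_def is_arg_min_def)
  then show ?thesis by (auto simp: X_star_def)
qed

end
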